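(* Let $({\bf v}_n)_{n\ge 0}$ be a sequence in $\mathbb{R}^2$ generated by the non-ideal iterative rule with restitution coefficient $\varepsilon\in[0,1)$ (defined in the context) from some ${\bf v}_0\in\mathbb{R}^2$. If ${\bf v}_n\notin\mathcal{Z}_0$ for every $n$, then $\lim_{n\to+\infty}\|{\bf v}_n\|=0$.
   Context: A rigid disk is simultaneously in contact with two walls forming a corner of angle $2\alpha\in(0,\pi)$; put $k=\tan\alpha>0$. Let $\varepsilon\in[0,1)$ be a restitution coefficient. The linear velocity of the disk is a pair $(\dot x,\dot y)\in\mathbb{R}^2$, and $\|(\dot x,\dot y)\|=\sqrt{\dot x^2+\dot y^2}$. The plane of velocities is partitioned into four zones: $\mathcal{Z}_0=\{k\dot x+\dot y\le 0,\ k\dot x-\dot y\le 0\}$ (exit velocities), $\mathcal{Z}_1=\{k\dot x+\dot y\le 0,\ k\dot x-\dot y>0\}$ (impact with the first wall only), $\mathcal{Z}_2=\{k\dot x+\dot y>0,\ k\dot x-\dot y\le 0\}$ (impact with the second wall only), $\mathcal{Z}_{12}=\{k\dot x+\dot y>0,\ k\dot x-\dot y>0\}$ (multiple impact). Non-ideal iterative rule. Given ${\bf v}_n=(\dot x_n,\dot y_n)$, define ${\bf v}_{n+1}=(\dot x_{n+1},\dot y_{n+1})$ by: - if ${\bf v}_n\in\mathcal{Z}_0$: ${\bf v}_{n+1}={\bf v}_n$; - if ${\bf v}_n\in\mathcal{Z}_1$: $\dot x_{n+1}=\frac{1-\varepsilon k^2}{1+k^2}\dot x_n+\frac{(1+\varepsilon)k}{1+k^2}\dot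 y_n$, $\ \dot y_{n+1}=\frac{(1+\varepsilon)k}{1+k^2}\dot x_n-\frac{\varepsilon-k^2}{1+k^2}\dot y_n$; - if ${\bf v}_n\in\mathcal{Z}_2$: $\dot x_{n+1}=\frac{1-\varepsilon k^2}{1+k^2}\dot x_n-\frac{(1+\varepsilon)k}{1+k^2}\dot y_n$, $\ \dot y_{n+1}=-\frac{(1+\varepsilon)k}{1+k^2}\dot x_n-\frac{\varepsilon-k^2}{1+k^2}\dot y_n$; - if ${\bf v}_n\in\mathcal{Z}_{12}$: $\dot x_{n+1}=\frac{-\varepsilon k^4\dot x_n^2+(1-(1+\varepsilon)k^2)\dot y_n^2}{k^4\dot x_n^2+\dot y_n^2}\,\dot x_n$, $\ \dot y_{n+1}=\frac{k^2(k^2-(1+\varepsilon))\dot x_n^2-\varepsilon\dot y_n^2}{k^4\dot x_n^2+\dot y_n^2}\,\dot y_n$. *)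

theory Defs
  imports "HOL-Analysis.Analysis"
begin

text \<open>
  Velocities are pairs of type \<^typ>\<open>real \<times> real\<close>; the library norm on this type is the Euclidean one.
  The parameter \<open>k\<close> is the tangent of the half angle of the corner.
\<close>

definition Zone0 :: "real \<Rightarrow> (real \<times> real) set" where
  "Zone0 k = {(x, y). k * x + y \<le> 0 \<and> k * x - y \<le> 0}"

definition Zone1 :: "real \<Rightarrow> (real \<times> real) set" where
  "Zone1 k = {(x, y). k * x + y \<le> 0 \<and> k * x - y > 0}"

definition Zone2 :: "real \<Rightarrow> (real \<times> real) set" where
  "Zone2 k = {(x, y). k * x + y > 0 \<and> k * x - y \<le> 0}"

definition Zone12 :: "real \<Rightarrow> (real \<times> real) set" where
  "Zone12 k = {(x, y). k * x + y > 0 \<and> k * x - y > 0}"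

definition impact1 :: "real \<Rightarrow> real \<Rightarrow> real \<times> real \<Rightarrow> real \<times> real" where
  "impact1 k \<epsilon> = (\<lambda>(x, y).
     ((1 - \<epsilon> * k^2) / (1 + k^2) * x + (1 + \<epsilon>) * k / (1 + k^2) * y,
      (1 + \<epsilon>) * k / (1 + k^2) * x - (\<epsilon> - k^2) / (1 + k^2) * y))"

definition impact2 :: "real \<Rightarrow> real \<Rightarrow> real \<times> real \<Rightarrow> real \<times> real" where
  "impact2 k \<epsilon> = (\<lambda>(x, y).
     ((1 - \<epsilon> * k^2) / (1 + k^2) * x - (1 + \<epsilon>) * k / (1 + k^2) * y,
      - ((1 + \<epsilon>) * k / (1 + k^2)) * x - (\<epsilon> - k^2) / (1 + k^2) * y))"

text \<open>The denominator below is positive on \<^term>\<open>Zone12 k\<close> when \<open>k > 0\<close>, since there \<open>k * x > \<bar>y\<bar>\<close>.\<close>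

definition impact12 :: "real \<Rightarrow> real \<Rightarrow> real \<times> real \<Rightarrow> real \<times> real" where
  "impact12 k \<epsilon> = (\<lambda>(x, y).
     ((- \<epsilon> * k^4 * x^2 + (1 - (1 + \<epsilon>) * k^2) * y^2) / (k^4 * x^2 + y^2) * x,
      (k^2 * (k^2 - (1 + \<epsilon>)) * x^2 - \<epsilon> * y^2) / (k^4 * x^2 + y^2) * y))"

text \<open>The four zones partition the plane, so the last branch is exactly the case \<^term>\<open>v \<in> Zone12 k\<close>.\<close>

definition impact_step :: "real \<Rightarrow> real \<Rightarrow> real \<times> real \<Rightarrow> real \<times> real" where
  "impact_step k \<epsilon> v =
     (if v \<in> Zone0 k then v
      else if v \<in> Zone1 k then impact1 k \<epsilon> v
      else if v \<in> Zone2 k then impact2 k \<epsilon> v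
      else impact12 k \<epsilon> v)"

lemma zones_cover: "Zone0 k \<union> Zone1 k \<union> Zone2 k \<union> Zone12 k = UNIV"
  by (auto simp: Zone0_def Zone1_def Zone2_def Zone12_def)

lemma zones_disjoint:
  "Zone0 k \<inter> Zone1 k = {}" "Zone0 k \<inter> Zone2 k = {}" "Zone0 k \<inter> Zone12 k = {}"
  "Zone1 k \<inter> Zone2 k = {}" "Zone1 k \<inter> Zone12 k = {}" "Zone2 k \<inter> Zone12 k = {}"
  by (auto simp: Zone0_def Zone1_def Zone2_def Zone12_def)

end

theory Submission
  imports Defs
begin

text \<open>
  Every branch of the rule is one inelastic impact against a suitable normal \<open>u\<close>: the component of
  the velocity along \<open>u\<close> is multiplied by \<open>- \<epsilon>\<close> and the orthogonal component is kept.  For the single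
  impacts \<open>u\<close> is the wall normal \<open>(k, - 1)\<close> or \<open>(k, 1)\<close>; for the multiple impact of \<open>(x, y)\<close> it is
  \<open>(k\<^sup>2 x, y)\<close>.  Such an impact removes exactly \<open>(1 - \<epsilon>\<^sup>2) (v \<bullet> u)\<^sup>2 / (u \<bullet> u)\<close> from the squared speed,
  so the squared speeds decrease to some limit \<open>L \<ge> 0\<close>.

  The loss in two consecutive steps controls the speed between them (\<open>energy_bound_by_two_losses\<close>).
  A multiple impact alone already destroys a fixed fraction of the energy, because \<open>v\<close> and
  \<open>(k\<^sup>2 x, y)\<close> enclose an angle bounded away from a right angle.  After an impact with one wall, the
  velocity leaves that wall; if it is no exit velocity, the next impact is therefore with the other
  wall only.  The two losses then bound the components of the intermediate velocity along both
  wall normals, and these normals span the plane.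

  So \<open>\<parallel>v\<^sub>n\<^sub>+\<^sub>1\<parallel>\<^sup>2 \<le> C (\<parallel>v\<^sub>n\<parallel>\<^sup>2 - \<parallel>v\<^sub>n\<^sub>+\<^sub>2\<parallel>\<^sup>2)\<close> for a constant \<open>C\<close>, and letting \<open>n\<close> tend to infinity gives
  \<open>L \<le> C (L - L) = 0\<close>.
\<close>

section \<open>Inelastic impacts and the four branches of the rule\<close>

definition inelastic_impact :: "real \<Rightarrow> 'a::real_inner \<Rightarrow> 'a \<Rightarrow> 'a" where
  "inelastic_impact \<epsilon> u v = v - ((1 + \<epsilon>) * (v \<bullet> u) / (u \<bullet> u)) *\<^sub>R u"

lemma inner_inelastic_impact: "inelastic_impact \<epsilon> u v \<bullet> u = - \<epsilon> * (v \<bullet> u)"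
proof (cases "u = 0")
  case False
  then have "(1 + \<epsilon>) * (v \<bullet> u) / (u \<bullet> u) * (u \<bullet> u) = (1 + \<epsilon>) * (v \<bullet> u)" by simp
  then show ?thesis
    unfolding inelastic_impact_def inner_diff_left inner_scaleR_left by (simp add: algebra_simps)
qed (simp add: inelastic_impact_def)

lemma inelastic_impact_energy_loss:
  "(norm v)\<^sup>2 - (norm (inelastic_impact \<epsilon> u v))\<^sup>2 = (1 - \<epsilon>\<^sup>2) * (v \<bullet> u)\<^sup>2 / (u \<bullet> u)"
proof (cases "u = 0")
  case False
  define c where "c = (v \<bullet> u) / (u \<bullet> u)"
  have c: "v \<bullet> u = c * (u \<bullet> u)" using False by (simp add: c_def)
  have impact: "inelastic_impact \<epsilon> u v = v - ((1 + \<epsilon>) * c) *\<^sub>R u"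
    by (simp add: inelastic_impact_def c_def)
  have loss: "(1 - \<epsilon>\<^sup>2) * (v \<bullet> u)\<^sup>2 / (u \<bullet> u) = (1 - \<epsilon>\<^sup>2) * c * (v \<bullet> u)"
    by (simp add: c_def power2_eq_square)
  show ?thesis
    unfolding loss impact power2_norm_eq_inner
    by (simp add: inner_diff_left inner_diff_right inner_commute[of u v] c power2_eq_square
        algebra_simps)
qed (simp add: inelastic_impact_def)

lemma impact1_eq_inelastic_impact: "impact1 k \<epsilon> v = inelastic_impact \<epsilon> (k, - 1) v"
proof -
  define D where "D = 1 + k\<^sup>2"
  have "D \<noteq> 0" unfolding D_def by (metis add_pos_nonneg less_irrefl zero_le_power2 zero_less_one)
  have u: "(k, - 1 :: real) \<bullet> (k, - 1) = D" by (simp add: D_def power2_eq_square)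
  have num: "1 - \<epsilon> * k\<^sup>2 = D - (1 + \<epsilon>) * k\<^sup>2" "\<epsilon> - k\<^sup>2 = (1 + \<epsilon>) - D"
    by (simp_all add: D_def algebra_simps)
  show ?thesis
    unfolding impact1_def inelastic_impact_def u num D_def[symmetric]
    using \<open>D \<noteq> 0\<close> by (cases v) (simp add: field_simps power2_eq_square)
qed

lemma impact2_eq_inelastic_impact: "impact2 k \<epsilon> v = inelastic_impact \<epsilon> (k, 1) v"
proof -
  define D where "D = 1 + k\<^sup>2"
  have "D \<noteq> 0" unfolding D_def by (metis add_pos_nonneg less_irrefl zero_le_power2 zero_less_one)
  have u: "(k, 1 :: real) \<bullet> (k, 1) = D" by (simp add: D_def power2_eq_square)
  have num: "1 - \<epsilon> * k\<^sup>2 = D - (1 + \<epsilon>) * k\<^sup>2" "\<epsilon> - k\<^sup>2 = (1 + \<epsilon>) - D"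
    by (simp_all add: D_def algebra_simps)
  show ?thesis
    unfolding impact2_def inelastic_impact_def u num D_def[symmetric]
    using \<open>D \<noteq> 0\<close> by (cases v) (simp add: field_simps power2_eq_square)
qed

lemma impact12_eq_inelastic_impact:
  assumes "k^4 * x\<^sup>2 + y\<^sup>2 \<noteq> 0"
  shows "impact12 k \<epsilon> (x, y) = inelastic_impact \<epsilon> (k\<^sup>2 * x, y) (x, y)"
proof -
  define D where "D = k^4 * x\<^sup>2 + y\<^sup>2"
  have "D \<noteq> 0" using assms by (simp add: D_def)
  have u: "(k\<^sup>2 * x, y) \<bullet> (k\<^sup>2 * x, y) = D"
    by (simp add: D_def power2_eq_square power4_eq_xxxx)
  have num: "- \<epsilon> * k^4 * x\<^sup>2 + (1 - (1 + \<epsilon>) * k\<^sup>2) * y\<^sup>2 = D - (1 + \<epsilon>) * (k\<^sup>2 * x\<^sup>2 + y\<^sup>2) * k\<^sup>2"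
    "k\<^sup>2 * (k\<^sup>2 - (1 + \<epsilon>)) * x\<^sup>2 - \<epsilon> * y\<^sup>2 = D - (1 + \<epsilon>) * (k\<^sup>2 * x\<^sup>2 + y\<^sup>2)"
    by (simp_all add: D_def power2_eq_square power4_eq_xxxx algebra_simps)
  show ?thesis
    unfolding impact12_def inelastic_impact_def u case_prod_conv num D_def[symmetric]
    using \<open>D \<noteq> 0\<close> by (simp add: field_simps power2_eq_square)
qed

lemma impact_step_cases:
  assumes "v \<notin> Zone0 k"
  obtains
    (first) "0 < v \<bullet> (k, - 1)" "v \<bullet> (k, 1) \<le> 0" "impact_step k \<epsilon> v = inelastic_impact \<epsilon> (k, - 1) v"
  | (second) "v \<bullet> (k, - 1) \<le> 0" "0 < v \<bullet> (k, 1)" "impact_step k \<epsilon> v = inelastic_impact \<epsilon> (k, 1) v"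
  | (both) "v \<in> Zone12 k" "impact_step k \<epsilon> v = impact12 k \<epsilon> v"
proof -
  consider "v \<in> Zone1 k" | "v \<in> Zone2 k" | "v \<in> Zone12 k"
    using assms zones_cover[of k] by blast
  then show thesis
  proof cases
    case 1
    then have "0 < v \<bullet> (k, - 1)" "v \<bullet> (k, 1) \<le> 0"
      by (auto simp: Zone1_def mult.commute)
    with first assms 1 show thesis
      by (simp add: impact_step_def impact1_eq_inelastic_impact)
  next
    case 2
    then have "v \<bullet> (k, - 1) \<le> 0" "0 < v \<bullet> (k, 1)"
      by (auto simp: Zone2_def mult.commute)
    moreover have "v \<notin> Zone1 k" using 2 zones_disjoint by blast
    ultimately show thesis
      using second assms 2 by (simp add: impact_step_def impact2_eq_inelastic_impact)
  next
    case 3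
    moreover have "v \<notin> Zone1 k" "v \<notin> Zone2 k" using 3 zones_disjoint by blast+
    ultimately show thesis
      using both assms by (simp add: impact_step_def)
  qed
qed

section \<open>Energy loss in one step\<close>

lemma impact12_energy_loss:
  assumes "k > 0" "(x, y) \<in> Zone12 k"
  shows "(norm (x, y))\<^sup>2 - (norm (impact12 k \<epsilon> (x, y)))\<^sup>2
    = (1 - \<epsilon>\<^sup>2) * (k\<^sup>2 * x\<^sup>2 + y\<^sup>2)\<^sup>2 / (k^4 * x\<^sup>2 + y\<^sup>2)"
proof -
  have "k * x > 0" using assms(2) by (auto simp: Zone12_def)
  then have "x \<noteq> 0" by auto
  then have "k^4 * x\<^sup>2 + y\<^sup>2 > 0" using \<open>k > 0\<close> by (simp add: add_pos_nonneg)
  then have "impact12 k \<epsilon> (x, y) = inelastic_impact \<epsilon> (k\<^sup>2 * x, y) (x, y)"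
    by (intro impact12_eq_inelastic_impact) simp
  then show ?thesis
    using inelastic_impact_energy_loss[of "(x, y)" \<epsilon> "(k\<^sup>2 * x, y)"]
    by (simp add: power2_eq_square power4_eq_xxxx mult_ac)
qed

lemma norm_impact_step_le:
  assumes "k > 0" "0 \<le> \<epsilon>" "\<epsilon> < 1"
  shows "(norm (impact_step k \<epsilon> v))\<^sup>2 \<le> (norm v)\<^sup>2"
proof (cases "v \<in> Zone0 k")
  case False
  have T: "0 \<le> 1 - \<epsilon>\<^sup>2" using assms by (simp add: power_le_one)
  have *: "(norm (inelastic_impact \<epsilon> u v))\<^sup>2 \<le> (norm v)\<^sup>2" for u
  proof -
    have "0 \<le> (1 - \<epsilon>\<^sup>2) * (v \<bullet> u)\<^sup>2 / (u \<bullet> u)" using T by simp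
    then show ?thesis using inelastic_impact_energy_loss[of v \<epsilon> u] by linarith
  qed
  from False show ?thesis
  proof (cases rule: impact_step_cases[of v k \<epsilon>])
    case both
    obtain x y where v: "v = (x, y)" by (cases v)
    have "0 \<le> (1 - \<epsilon>\<^sup>2) * (k\<^sup>2 * x\<^sup>2 + y\<^sup>2)\<^sup>2 / (k^4 * x\<^sup>2 + y\<^sup>2)" using T by simp
    then show ?thesis
      using impact12_energy_loss[of k x y \<epsilon>] assms(1) both v
      by (metis diff_ge_0_iff_ge)
  qed (use * in auto)
qed (simp add: impact_step_def)

text \<open>
  The two wall normals span the plane, so the components along them control the speed.  For
  \<open>v = (x, y)\<close> their squares add up to \<open>2 (k\<^sup>2 x\<^sup>2 + y\<^sup>2)\<close>; the constant is not optimal, but it is the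
  one for which single and multiple impacts obey the same bound.
\<close>

lemma norm_le_normal_components:
  fixes v :: "real \<times> real"
  shows "k\<^sup>2 * (norm v)\<^sup>2 \<le> (1 + k\<^sup>2) * ((v \<bullet> (k, - 1))\<^sup>2 + (v \<bullet> (k, 1))\<^sup>2)"
proof -
  obtain x y where v: "v = (x, y)" by (cases v)
  have "(1 + k\<^sup>2) * ((v \<bullet> (k, - 1))\<^sup>2 + (v \<bullet> (k, 1))\<^sup>2) - k\<^sup>2 * (norm v)\<^sup>2
      = k\<^sup>2 * x\<^sup>2 + 2 * y\<^sup>2 + (k * k * x)\<^sup>2 * 2 + (k * y)\<^sup>2"
    unfolding v power2_norm_eq_inner by (simp add: power2_eq_square algebra_simps)
  also have "\<dots> \<ge> 0" by simp
  finally show ?thesis by simp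
qed

text \<open>
  With \<open>S = k\<^sup>2 x\<^sup>2 + y\<^sup>2\<close> the loss is \<open>(1 - \<epsilon>\<^sup>2) S\<^sup>2 / (k\<^sup>4 x\<^sup>2 + y\<^sup>2)\<close>, and \<open>S\<close> is comparable both with the
  denominator and with the squared speed.
\<close>

lemma impact12_energy_bound:
  assumes "k > 0" "0 \<le> \<epsilon>" "\<epsilon> < 1" "v \<in> Zone12 k"
  shows "k\<^sup>2 * (1 - \<epsilon>\<^sup>2) * (norm v)\<^sup>2 \<le> (1 + k\<^sup>2)\<^sup>2 * ((norm v)\<^sup>2 - (norm (impact12 k \<epsilon> v))\<^sup>2)"
proof -
  obtain x y where v: "v = (x, y)" by (cases v)
  define S where "S = k\<^sup>2 * x\<^sup>2 + y\<^sup>2"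
  define D where "D = k^4 * x\<^sup>2 + y\<^sup>2"
  have T: "0 \<le> 1 - \<epsilon>\<^sup>2" using assms by (simp add: power_le_one)
  have "x \<noteq> 0" using assms by (auto simp: Zone12_def v)
  then have "D > 0" using \<open>k > 0\<close> by (simp add: D_def add_pos_nonneg)
  have "S \<ge> 0" by (simp add: S_def)
  have "(1 + k\<^sup>2) * S - D = k\<^sup>2 * x\<^sup>2 + k\<^sup>2 * y\<^sup>2"
    by (simp add: S_def D_def power2_eq_square power4_eq_xxxx algebra_simps)
  then have "D \<le> (1 + k\<^sup>2) * S" by (smt (verit) mult_nonneg_nonneg zero_le_power2)
  then have "D * S \<le> (1 + k\<^sup>2) * S * S" using \<open>S \<ge> 0\<close> by (rule mult_right_mono)
  then have S_le: "S \<le> (1 + k\<^sup>2) * (S\<^sup>2 / D)"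
    using \<open>D > 0\<close> by (simp add: field_simps power2_eq_square)
  have "(1 + k\<^sup>2) * S - k\<^sup>2 * (norm v)\<^sup>2 = y\<^sup>2 + k^4 * x\<^sup>2"
    unfolding v S_def power2_norm_eq_inner
    by (simp add: power2_eq_square power4_eq_xxxx algebra_simps)
  moreover have "0 \<le> y\<^sup>2 + k^4 * x\<^sup>2" by simp
  ultimately have "k\<^sup>2 * (norm v)\<^sup>2 \<le> (1 + k\<^sup>2) * S" by linarith
  also have "\<dots> \<le> (1 + k\<^sup>2) * ((1 + k\<^sup>2) * (S\<^sup>2 / D))"
    using S_le by (intro mult_left_mono) auto
  finally have "(1 - \<epsilon>\<^sup>2) * (k\<^sup>2 * (norm v)\<^sup>2) \<le> (1 - \<epsilon>\<^sup>2) * ((1 + k\<^sup>2) * ((1 + k\<^sup>2) * (S\<^sup>2 / D)))"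
    using T by (rule mult_left_mono)
  also have "\<dots> = (1 + k\<^sup>2)\<^sup>2 * ((1 - \<epsilon>\<^sup>2) * S\<^sup>2 / D)"
    by (simp add: power2_eq_square)
  also have "(1 - \<epsilon>\<^sup>2) * S\<^sup>2 / D = (norm v)\<^sup>2 - (norm (impact12 k \<epsilon> v))\<^sup>2"
    using impact12_energy_loss[of k x y \<epsilon>] assms v by (simp add: S_def D_def)
  finally show ?thesis by (simp add: mult_ac)
qed

section \<open>Energy loss in two consecutive steps\<close>

text \<open>
  The first impact leaves \<open>- \<epsilon>\<close> times the old component along its own normal, the second impact
  acts on the component along the other normal; each loss measures the component it acts on, and
  \<open>\<epsilon> \<le> 1\<close>.  The sign \<open>s\<close> selects which wall is hit first.
\<close>

lemma alternating_impacts_energy_bound: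
  fixes v w :: "real \<times> real"
  assumes "0 \<le> \<epsilon>" "\<epsilon> < 1"
    and s: "s = 1 \<or> s = - 1"
    and w: "w = inelastic_impact \<epsilon> (k, s) v"
    and w': "w' = inelastic_impact \<epsilon> (k, - s) w"
  shows "k\<^sup>2 * (1 - \<epsilon>\<^sup>2) * (norm w)\<^sup>2 \<le> (1 + k\<^sup>2)\<^sup>2 * ((norm v)\<^sup>2 - (norm w')\<^sup>2)"
proof -
  define p where "p = v \<bullet> (k, s)"
  define q where "q = w \<bullet> (k, - s)"
  have T: "0 \<le> 1 - \<epsilon>\<^sup>2" using assms by (simp add: power_le_one)
  have K: "0 < 1 + k\<^sup>2" by (simp add: add_pos_nonneg)
  have normal: "(k, s) \<bullet> (k, s) = 1 + k\<^sup>2" "(k, - s) \<bullet> (k, - s) = 1 + k\<^sup>2"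
    using s by (auto simp: power2_eq_square)
  have "(norm v)\<^sup>2 - (norm w)\<^sup>2 = (1 - \<epsilon>\<^sup>2) * p\<^sup>2 / (1 + k\<^sup>2)"
    "(norm w)\<^sup>2 - (norm w')\<^sup>2 = (1 - \<epsilon>\<^sup>2) * q\<^sup>2 / (1 + k\<^sup>2)"
    unfolding w' unfolding w p_def q_def inelastic_impact_energy_loss normal by simp_all
  then have "(norm v)\<^sup>2 - (norm w')\<^sup>2 = (1 - \<epsilon>\<^sup>2) * (p\<^sup>2 + q\<^sup>2) / (1 + k\<^sup>2)"
    by (simp add: add_divide_distrib diff_divide_distrib algebra_simps)
  then have losses: "(1 + k\<^sup>2) * ((norm v)\<^sup>2 - (norm w')\<^sup>2) = (1 - \<epsilon>\<^sup>2) * (p\<^sup>2 + q\<^sup>2)"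
    using K by simp
  have "w \<bullet> (k, s) = - \<epsilon> * p"
    unfolding w p_def by (rule inner_inelastic_impact)
  then have "(w \<bullet> (k, - 1))\<^sup>2 + (w \<bullet> (k, 1))\<^sup>2 = (- \<epsilon> * p)\<^sup>2 + q\<^sup>2"
    using s q_def by (elim disjE) simp_all
  also have "\<dots> \<le> p\<^sup>2 + q\<^sup>2"
    using T by (simp add: power_mult_distrib mult_left_le_one_le)
  finally have "(1 + k\<^sup>2) * ((w \<bullet> (k, - 1))\<^sup>2 + (w \<bullet> (k, 1))\<^sup>2) \<le> (1 + k\<^sup>2) * (p\<^sup>2 + q\<^sup>2)"
    using K by (intro mult_left_mono) auto
  with norm_le_normal_components[of k w]
  have "k\<^sup>2 * (norm w)\<^sup>2 \<le> (1 + k\<^sup>2) * (p\<^sup>2 + q\<^sup>2)" by (rule order_trans)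
  then have "(1 - \<epsilon>\<^sup>2) * (k\<^sup>2 * (norm w)\<^sup>2) \<le> (1 - \<epsilon>\<^sup>2) * ((1 + k\<^sup>2) * (p\<^sup>2 + q\<^sup>2))"
    using T by (rule mult_left_mono)
  also have "\<dots> = (1 + k\<^sup>2) * ((1 + k\<^sup>2) * ((norm v)\<^sup>2 - (norm w')\<^sup>2))"
    unfolding losses by simp
  finally show ?thesis by (simp add: power2_eq_square mult_ac)
qed

text \<open>
  Two steps are needed because a single impact may be nearly tangential and then costs almost no
  energy.
\<close>

lemma energy_bound_by_two_losses:
  assumes "k > 0" "0 \<le> \<epsilon>" "\<epsilon> < 1"
    and w: "w = impact_step k \<epsilon> v" and w': "w' = impact_step k \<epsilon> w"
    and v0: "v \<notin> Zone0 k" and w0: "w \<notin> Zone0 k"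
  shows "k\<^sup>2 * (1 - \<epsilon>\<^sup>2) * (norm w)\<^sup>2 \<le> (1 + k\<^sup>2)\<^sup>2 * ((norm v)\<^sup>2 - (norm w')\<^sup>2)"
  using v0
proof (cases rule: impact_step_cases[of v k \<epsilon>])
  case first
  (* Leaving the first wall rules out both the first wall and the multiple impact for the next step. *)
  have "w \<bullet> (k, - 1) \<le> 0"
    using first assms(2) w by (simp add: inner_inelastic_impact del: inner_Pair)
  with w0 have "w' = inelastic_impact \<epsilon> (k, 1) w"
    unfolding w' by (cases rule: impact_step_cases[of w k \<epsilon>]) (auto simp: Zone12_def mult.commute)
  then show ?thesis
    using alternating_impacts_energy_bound[of \<epsilon> "- 1" w k v w'] assms(2,3) first(3) w by simp
next
  case second
  have "w \<bullet> (k, 1) \<le> 0"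
    using second assms(2) w by (simp add: inner_inelastic_impact del: inner_Pair)
  with w0 have "w' = inelastic_impact \<epsilon> (k, - 1) w"
    unfolding w' by (cases rule: impact_step_cases[of w k \<epsilon>]) (auto simp: Zone12_def mult.commute)
  then show ?thesis
    using alternating_impacts_energy_bound[of \<epsilon> 1 w k v w'] assms(2,3) second(3) w by simp
next
  case both
  have T: "0 \<le> 1 - \<epsilon>\<^sup>2" using assms(2,3) by (simp add: power_le_one)
  have wv: "(norm w)\<^sup>2 \<le> (norm v)\<^sup>2" and w'w: "(norm w')\<^sup>2 \<le> (norm w)\<^sup>2"
    unfolding w w' using norm_impact_step_le[OF assms(1-3)] by blast+
  have "k\<^sup>2 * (1 - \<epsilon>\<^sup>2) * (norm w)\<^sup>2 \<le> k\<^sup>2 * (1 - \<epsilon>\<^sup>2) * (norm v)\<^sup>2"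
    using wv T by (intro mult_left_mono) auto
  also have "\<dots> \<le> (1 + k\<^sup>2)\<^sup>2 * ((norm v)\<^sup>2 - (norm w)\<^sup>2)"
    using impact12_energy_bound[OF assms(1-3) both(1)] both(2) w by simp
  also have "\<dots> \<le> (1 + k\<^sup>2)\<^sup>2 * ((norm v)\<^sup>2 - (norm w')\<^sup>2)"
    using w'w by (intro mult_left_mono) auto
  finally show ?thesis .
qed

section \<open>Decay of the speed\<close>

theorem theorem5p3:
  fixes \<alpha> k \<epsilon> :: real and v :: "nat \<Rightarrow> real \<times> real"
  assumes "0 < 2 * \<alpha>" and "2 * \<alpha> < pi"
    and "k = tan \<alpha>"
    and "0 \<le> \<epsilon>" and "\<epsilon> < 1"
    and "\<And>n. v (Suc n) = impact_step k \<epsilon> (v n)"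
    and "\<And>n. v n \<notin> Zone0 k"
  shows "(\<lambda>n. norm (v n)) \<longlonglongrightarrow> 0"
proof -
  have k: "k > 0" using assms(1-3) by (simp add: tan_gt_zero)
  define E where "E n = (norm (v n))\<^sup>2" for n
  define c where "c = k\<^sup>2 * (1 - \<epsilon>\<^sup>2)"
  have c: "c > 0"
    using k assms(4,5) by (simp add: c_def power_less_one_iff)
  have "decseq E"
    unfolding E_def assms(6)
    by (rule decseq_SucI) (simp add: assms(6) norm_impact_step_le[OF k assms(4,5)])
  then obtain L where L: "E \<longlonglongrightarrow> L"
    by (rule decseq_convergent[where B = 0]) (auto simp: E_def)
  have E1: "(\<lambda>n. E (Suc n)) \<longlonglongrightarrow> L" using L by (rule LIMSEQ_Suc)
  then have E2: "(\<lambda>n. E (Suc (Suc n))) \<longlonglongrightarrow> L" by (rule LIMSEQ_Suc)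
  have "c * E (Suc n) \<le> (1 + k\<^sup>2)\<^sup>2 * (E n - E (Suc (Suc n)))" for n
    unfolding E_def c_def
    by (rule energy_bound_by_two_losses[OF k assms(4,5) assms(6) assms(6) assms(7) assms(7)])
  moreover have "(\<lambda>n. c * E (Suc n)) \<longlonglongrightarrow> c * L"
    by (intro tendsto_intros E1)
  moreover have "(\<lambda>n. (1 + k\<^sup>2)\<^sup>2 * (E n - E (Suc (Suc n)))) \<longlonglongrightarrow> (1 + k\<^sup>2)\<^sup>2 * (L - L)"
    by (intro tendsto_intros L E2)
  ultimately have "c * L \<le> (1 + k\<^sup>2)\<^sup>2 * (L - L)"
    by (blast intro: LIMSEQ_le)
  then have "L \<le> 0" using c by (simp add: mult_le_0_iff)
  moreover have "0 \<le> L" by (rule LIMSEQ_le_const[OF L]) (auto simp: E_def)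
  ultimately have "E \<longlonglongrightarrow> 0" using L by simp
  then have "(\<lambda>n. sqrt (E n)) \<longlonglongrightarrow> 0" using tendsto_real_sqrt by fastforce
  then show ?thesis by (simp add: E_def)
qed

end
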